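(* Let $\Delta=\alpha_1\wedge\cdots\wedge\alpha_n$ be a CNF and let $\ell$ be a literal. Then the CNF obtained by removing literal $\bar{\ell}$ from every clause $\alpha_i$ of $\Delta$ is logically equivalent to $\forall \ell\cdot\Delta$. Moreover, if $\Delta$ is closed under resolution on the variable of literal $\ell$, then the CNF obtained by removing from $\Delta$ every clause $\alpha_i$ that contains literal $\ell$ is logically equivalent to $\exists \ell\cdot\Delta$.
   Context: A literal of Boolean variable $X$ is $x$ or $\bar{x}$; $\bar{\ell}$ denotes the complement of literal $\ell$. A clause is a set of literals over distinct variables, read as the disjunction of its literals (the empty clause is false). A CNF is a finite set of clauses, read as their conjunction. The resolution of clauses $x\vee\alpha$ and $\bar{x}\vee\beta$ on variable $X$ leads to the clause $\alpha\vee\beta$ when $\alpha$ and $\beta$ share no complementary literals. A CNF is closed under resolution on variable $X$ iff the result of each such resolution on $X$ between clauses of the CNF is in the CNF. Conditioning: $\varphi|x$ (resp. $\varphi|\bar{x}$) is obtained by replacing every occurrence of variable $X$ in $\varphi$ with true (resp. false). Literal quantification is defined by $\forall \ell\cdot\varphi = (\ell\vee(\varphi|\bar{\ell}))\wedge(\varphi|\ell)$ and $\exists \ell\cdot\varphi=(\varphi|\ell)\vee(\bar{\ell}\wedge(\varphi|\bar{\ell}))$. *)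

theory Defs
  imports "HOL-Library.FSet"
begin

datatype 'v literal = Pos 'v | Neg 'v

primrec var_of :: "'v literal \<Rightarrow> 'v" where
  "var_of (Pos X) = X"
| "var_of (Neg X) = X"

primrec complement :: "'v literal \<Rightarrow> 'v literal" where
  "complement (Pos X) = Neg X"
| "complement (Neg X) = Pos X"

datatype 'v form =
    Verum
  | Falsum
  | Atom 'v
  | Negation "'v form"
  | Conj "'v form fset"
  | Disj "'v form fset"

(* The images under the recursive calls keep the recursion through fset primitive:
   the last two equations say that all members, respectively some member, of F hold. *)
primrec eval :: "('v \<Rightarrow> bool) \<Rightarrow> 'v form \<Rightarrow> bool" where
  "eval v Verum \<longleftrightarrow> True"
| "eval v Falsum \<longleftrightarrow> False"
| "eval v (Atom X) \<longleftrightarrow> v X"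
| "eval v (Negation \<phi>) \<longleftrightarrow> \<not> eval v \<phi>"
| "eval v (Conj F) \<longleftrightarrow> (\<forall>b. b |\<in>| eval v |`| F \<longrightarrow> b)"
| "eval v (Disj F) \<longleftrightarrow> (\<exists>b. b |\<in>| eval v |`| F \<and> b)"

definition equivalent :: "'v form \<Rightarrow> 'v form \<Rightarrow> bool" where
  "equivalent \<phi> \<psi> \<longleftrightarrow> (\<forall>v. eval v \<phi> = eval v \<psi>)"

primrec replace_var :: "'v \<Rightarrow> 'v form \<Rightarrow> 'v form \<Rightarrow> 'v form" where
  "replace_var X \<psi> Verum = Verum"
| "replace_var X \<psi> Falsum = Falsum"
| "replace_var X \<psi> (Atom Y) = (if Y = X then \<psi> else Atom Y)"
| "replace_var X \<psi> (Negation \<phi>) = Negation (replace_var X \<psi> \<phi>)"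
| "replace_var X \<psi> (Conj F) = Conj (replace_var X \<psi> |`| F)"
| "replace_var X \<psi> (Disj F) = Disj (replace_var X \<psi> |`| F)"

fun condition :: "'v form \<Rightarrow> 'v literal \<Rightarrow> 'v form" where
  "condition \<phi> (Pos X) = replace_var X Verum \<phi>"
| "condition \<phi> (Neg X) = replace_var X Falsum \<phi>"

primrec form_of_literal :: "'v literal \<Rightarrow> 'v form" where
  "form_of_literal (Pos X) = Atom X"
| "form_of_literal (Neg X) = Negation (Atom X)"

definition forall_literal :: "'v literal \<Rightarrow> 'v form \<Rightarrow> 'v form" where
  "forall_literal l \<phi> =
     Conj {|Disj {|form_of_literal l, condition \<phi> (complement l)|}, condition \<phi> l|}"

definition exists_literal :: "'v literal \<Rightarrow> 'v form \<Rightarrow> 'v form" where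
  "exists_literal l \<phi> =
     Disj {|condition \<phi> l,
            Conj {|form_of_literal (complement l), condition \<phi> (complement l)|}|}"

type_synonym 'v clause = "'v literal fset"
type_synonym 'v cnf = "'v clause fset"

definition is_clause :: "'v clause \<Rightarrow> bool" where
  "is_clause \<alpha> \<longleftrightarrow> inj_on var_of (fset \<alpha>)"

definition is_cnf :: "'v cnf \<Rightarrow> bool" where
  "is_cnf \<Delta> \<longleftrightarrow> (\<forall>\<alpha>. \<alpha> |\<in>| \<Delta> \<longrightarrow> is_clause \<alpha>)"

definition form_of_clause :: "'v clause \<Rightarrow> 'v form" where
  "form_of_clause \<alpha> = Disj (form_of_literal |`| \<alpha>)"

definition form_of_cnf :: "'v cnf \<Rightarrow> 'v form" where
  "form_of_cnf \<Delta> = Conj (form_of_clause |`| \<Delta>)"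

(* Here C and D are the parent clauses; the disjuncts other than the literals resolved upon
   are C minus the positive and D minus the negative literal of X. *)
definition closed_under_resolution :: "'v \<Rightarrow> 'v cnf \<Rightarrow> bool" where
  "closed_under_resolution X \<Delta> \<longleftrightarrow>
     (\<forall>C D. C |\<in>| \<Delta> \<and> D |\<in>| \<Delta> \<and> Pos X |\<in>| C \<and> Neg X |\<in>| D \<longrightarrow>
       (let \<alpha> = C |-| {|Pos X|}; \<beta> = D |-| {|Neg X|}
        in (\<nexists>k. k |\<in>| \<alpha> \<and> complement k |\<in>| \<beta>) \<longrightarrow> \<alpha> |\<union>| \<beta> |\<in>| \<Delta>))"

definition remove_literal :: "'v literal \<Rightarrow> 'v cnf \<Rightarrow> 'v cnf" where
  "remove_literal l \<Delta> = (\<lambda>\<alpha>. \<alpha> |-| {|l|}) |`| \<Delta>"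

definition remove_clauses_with :: "'v literal \<Rightarrow> 'v cnf \<Rightarrow> 'v cnf" where
  "remove_clauses_with l \<Delta> = ffilter (\<lambda>\<alpha>. l |\<notin>| \<alpha>) \<Delta>"

lemma is_cnf_remove_literal: "is_cnf \<Delta> \<Longrightarrow> is_cnf (remove_literal l \<Delta>)"
  by (auto simp: is_cnf_def is_clause_def remove_literal_def inj_on_diff)

lemma is_cnf_remove_clauses_with: "is_cnf \<Delta> \<Longrightarrow> is_cnf (remove_clauses_with l \<Delta>)"
  by (auto simp: is_cnf_def remove_clauses_with_def)

end

theory Submission
  imports Defs
begin

text \<open>Conditioning on \<open>l\<close> is evaluation at \<open>make_true l v\<close>
  (\<open>eval_condition\<close>), so both quantifiers compare \<open>v\<close> with the valuation
  flipped at one variable. If \<open>l\<close> holds at \<open>v\<close>, each reduces to \<Delta>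
  at \<open>v\<close>, where neither deleting the false literal \<open>complement l\<close> nor
  dropping the true clauses with \<open>l\<close> matters. If \<open>l\<close> fails, \<forall>
  demands \<Delta> at both valuations; this splits over clauses
  (\<open>clause_true_remove_complement\<close>). \<exists> demands \<Delta> at one of them: were
  both to fail, the failing clauses would resolve to a clause of \<Delta> without \<open>l\<close>
  that is false at \<open>v\<close> (\<open>eval_or_eval_make_true\<close>).\<close>

lemma complement_complement [simp]: "complement (complement l) = l"
  by (cases l) auto

lemma complement_neq [simp]: "complement l \<noteq> l" "l \<noteq> complement l"
  by (cases l; simp)+

lemma var_of_complement [simp]: "var_of (complement l) = var_of l"
  by (cases l) auto

abbreviation lit_true :: "('v \<Rightarrow> bool) \<Rightarrow> 'v literal \<Rightarrow> bool" where
  "lit_true v k \<equiv> eval v (form_of_literal k)"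

definition clause_true :: "('v \<Rightarrow> bool) \<Rightarrow> 'v clause \<Rightarrow> bool" where
  "clause_true v C \<longleftrightarrow> (\<exists>k. k |\<in>| C \<and> lit_true v k)"

lemma lit_true_complement [simp]: "lit_true v (complement l) \<longleftrightarrow> \<not> lit_true v l"
  by (cases l) auto

lemma eval_form_of_cnf: "eval v (form_of_cnf \<Delta>) \<longleftrightarrow> (\<forall>C. C |\<in>| \<Delta> \<longrightarrow> clause_true v C)"
  by (auto simp: form_of_cnf_def form_of_clause_def clause_true_def)

lemma complement_notin_clause:
  assumes "is_clause C" "l |\<in>| C"
  shows "complement l |\<notin>| C"
  using assms unfolding is_clause_def by (metis complement_neq(1) inj_onD var_of_complement)

text \<open>The value assigned to the variable is the sign of \<open>l\<close>.\<close>

definition make_true :: "'v literal \<Rightarrow> ('v \<Rightarrow> bool) \<Rightarrow> 'v \<Rightarrow> bool" where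
  "make_true l v = v(var_of l := (l = Pos (var_of l)))"

lemma lit_true_make_true:
  "lit_true (make_true l v) k \<longleftrightarrow> k = l \<or> k \<noteq> complement l \<and> lit_true v k"
  by (cases k; cases l) (auto simp: make_true_def)

lemma make_true_idem: "lit_true v l \<Longrightarrow> make_true l v = v"
  by (cases l) (auto simp: make_true_def fun_eq_iff)

lemma eval_replace_var:
  assumes "\<And>w. eval w \<psi> = b"
  shows "eval v (replace_var X \<psi> \<phi>) = eval (v(X := b)) \<phi>"
  by (induction \<phi>) (auto simp: assms)

lemma eval_condition: "eval v (condition \<phi> l) = eval (make_true l v) \<phi>"
  by (cases l) (auto simp: make_true_def eval_replace_var[where b = True]
      eval_replace_var[where b = False])

lemma eval_forall_literal:
  "eval v (forall_literal l \<phi>) \<longleftrightarrow>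
     (lit_true v l \<or> eval (make_true (complement l) v) \<phi>) \<and> eval (make_true l v) \<phi>"
  by (auto simp: forall_literal_def eval_condition)

lemma eval_exists_literal:
  "eval v (exists_literal l \<phi>) \<longleftrightarrow>
     eval (make_true l v) \<phi> \<or> \<not> lit_true v l \<and> eval (make_true (complement l) v) \<phi>"
  by (auto simp: exists_literal_def eval_condition)

text \<open>When \<open>l\<close> fails at \<open>v\<close>, a clause with
  \<open>complement l\<close> holds at \<open>v\<close> and, lacking \<open>l\<close>, needs some
  third literal to hold after the flip.\<close>

lemma clause_true_remove_complement:
  assumes "is_clause C"
  shows "clause_true v (C |-| {|complement l|}) \<longleftrightarrow>
     (lit_true v l \<or> clause_true (make_true (complement l) v) C) \<and> clause_true (make_true l v) C"
proof (cases "lit_true v l")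
  case True
  then show ?thesis
    by (auto simp: clause_true_def make_true_idem)
next
  case False
  then have "make_true (complement l) v = v"
    by (simp add: make_true_idem)
  with False complement_notin_clause[OF assms, of l] show ?thesis
    by (auto simp: clause_true_def lit_true_make_true)
qed

lemma forall_literal_cnf:
  assumes "is_cnf \<Delta>"
  shows "equivalent (form_of_cnf (remove_literal (complement l) \<Delta>))
           (forall_literal l (form_of_cnf \<Delta>))"
  using assms clause_true_remove_complement
  unfolding equivalent_def eval_forall_literal eval_form_of_cnf is_cnf_def remove_literal_def
  by (auto; blast)

text \<open>Closure is defined with the positive parent first; this form is free of the sign of
  \<open>l\<close>. For negative \<open>l\<close> the parents swap roles.\<close>

lemma closed_under_resolutionD:
  assumes "closed_under_resolution (var_of l) \<Delta>"
    and "C |\<in>| \<Delta>" "D |\<in>| \<Delta>" "l |\<in>| C" "complement l |\<in>| D"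
    and "\<And>k. k |\<in>| C |-| {|l|} \<Longrightarrow> complement k |\<notin>| D |-| {|complement l|}"
  shows "(C |-| {|l|}) |\<union>| (D |-| {|complement l|}) |\<in>| \<Delta>"
proof (cases l)
  case (Pos X)
  with assms show ?thesis
    unfolding closed_under_resolution_def Let_def by (metis complement.simps(1) var_of.simps(1))
next
  case (Neg X)
  have "complement k |\<notin>| C |-| {|l|}" if "k |\<in>| D |-| {|complement l|}" for k
    using assms(6)[of "complement k"] that by auto
  with assms(1-5) Neg have "(D |-| {|complement l|}) |\<union>| (C |-| {|l|}) |\<in>| \<Delta>"
    unfolding closed_under_resolution_def Let_def by (metis complement.simps(2) var_of.simps(2))
  then show ?thesis
    by (simp add: sup_commute)
qed

text \<open>If both disjuncts failed, the clauses witnessing this would have a resolvent that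
  lacks \<open>l\<close> and is false under \<open>v\<close>.\<close>
lemma eval_or_eval_make_true:
  assumes closed: "closed_under_resolution (var_of l) \<Delta>"
    and sat: "\<And>C. C |\<in>| \<Delta> \<Longrightarrow> l |\<notin>| C \<Longrightarrow> clause_true v C"
  shows "eval v (form_of_cnf \<Delta>) \<or> eval (make_true l v) (form_of_cnf \<Delta>)"
proof (rule ccontr)
  assume "\<not> ?thesis"
  then obtain C D where C: "C |\<in>| \<Delta>" "\<not> clause_true v C"
    and D: "D |\<in>| \<Delta>" "\<not> clause_true (make_true l v) D"
    unfolding eval_form_of_cnf by blast
  have lC: "l |\<in>| C"
    using C sat by blast
  have lD: "l |\<notin>| D"
    using D by (auto simp: clause_true_def lit_true_make_true)
  \<comment> \<open>The valuations differ only on the variable of \<open>l\<close>, and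
    \<open>D\<close> contains no \<open>l\<close>.\<close>
  have false_D: "\<not> clause_true v (D |-| {|complement l|})"
    using D by (auto simp: clause_true_def lit_true_make_true)
  have cD: "complement l |\<in>| D"
    using sat[OF D(1) lD] false_D by (auto simp: clause_true_def)
  \<comment> \<open>Both remainders are false at \<open>v\<close>, so they cannot hold complementary
    literals: one of the two would be true.\<close>
  have "complement k |\<notin>| D |-| {|complement l|}" if "k |\<in>| C |-| {|l|}" for k
    using that C(2) false_D unfolding clause_true_def by (metis fminusD1 lit_true_complement)
  then have "(C |-| {|l|}) |\<union>| (D |-| {|complement l|}) |\<in>| \<Delta>"
    using closed_under_resolutionD[OF closed C(1) D(1) lC cD] by blast
  then have "clause_true v ((C |-| {|l|}) |\<union>| (D |-| {|complement l|}))"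
    using sat lD by auto
  then show False
    using C(2) false_D by (auto simp: clause_true_def)
qed

lemma exists_literal_cnf:
  assumes "closed_under_resolution (var_of l) \<Delta>"
  shows "equivalent (form_of_cnf (remove_clauses_with l \<Delta>)) (exists_literal l (form_of_cnf \<Delta>))"
  unfolding equivalent_def
proof
  fix v
  have removed: "eval v (form_of_cnf (remove_clauses_with l \<Delta>)) \<longleftrightarrow>
      (\<forall>C. C |\<in>| \<Delta> \<longrightarrow> l |\<notin>| C \<longrightarrow> clause_true v C)"
    by (auto simp: eval_form_of_cnf remove_clauses_with_def)
  show "eval v (form_of_cnf (remove_clauses_with l \<Delta>)) = eval v (exists_literal l (form_of_cnf \<Delta>))"
  proof (cases "lit_true v l")
    case True
    then show ?thesis
      unfolding removed eval_exists_literal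
      by (auto simp: make_true_idem eval_form_of_cnf clause_true_def)
  next
    case False
    then have "make_true (complement l) v = v"
      by (simp add: make_true_idem)
    \<comment> \<open>Making \<open>l\<close> true can only help clauses that contain
      \<open>l\<close>.\<close>
    moreover have "clause_true v C" if "clause_true (make_true l v) C" "l |\<notin>| C" for C
      using that by (auto simp: clause_true_def lit_true_make_true)
    ultimately show ?thesis
      using eval_or_eval_make_true[OF assms] False
      unfolding removed eval_exists_literal by (auto simp: eval_form_of_cnf)
  qed
qed

theorem proposition21:
  fixes \<Delta> :: "'v cnf" and l :: "'v literal"
  assumes "is_cnf \<Delta>"
  shows "equivalent (form_of_cnf (remove_literal (complement l) \<Delta>))
           (forall_literal l (form_of_cnf \<Delta>)) \<and>
         (closed_under_resolution (var_of l) \<Delta> \<longrightarrow>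
           equivalent (form_of_cnf (remove_clauses_with l \<Delta>))
             (exists_literal l (form_of_cnf \<Delta>)))"
  using forall_literal_cnf exists_literal_cnf assms by blast

end
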